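(* Let $X^{\mathrm{in}}\subset\mathbb R^d$ be a nonempty polytope with $X^{\mathrm{in}}\neq\{0\}$, let $A$ be a real $d\times d$ matrix with spectral radius $\rho(A)<1$ admitting a decomposition $A=UDU^{-1}$ with $U$ a non-singular complex matrix and $D$ a complex diagonal matrix, let $Q$ be a real symmetric $d\times d$ matrix with $\lambda_{\max}(Q)\neq 0$, and let $q\in\mathbb R^d$. Let $\nu_k$, $V_{\rm diag}$ and $\mu$ be as defined in the context. Let $j\in\mathbb N$ with $\nu_j>0$ and define $$\mathbf K^{\rm diag}_\nu(j):=\left\lfloor\frac{\ln\left(\left(\sqrt{\nu_j+V_{\rm diag}^2}-V_{\rm diag}\right)\left(\sqrt{|\lambda_{\max}(U^*QU)|\,\mu\left((UU^* )^{-1}\right)}\right)^{-1}\right)}{\ln(\rho(A))}\right\rfloor+1 .$$ Then: 1. $\mathbf K^{\rm diag}_\nu(j)$ is well-defined, i.e. it is an integer greater than or equal to $1$; 2. For all $k\ge \mathbf K^{\rm diag}_\nu(j)$, $\nu_k\le\nu_j$.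
   Context: $\mathbb N=\{0,1,2,\dots\}$. A polytope is the convex hull of finitely many points. $U^*$ is the conjugate transpose; $\lambda_{\max}(B)$ is the greatest eigenvalue of a Hermitian matrix $B$. For $k\in\mathbb N$, $\nu_k=\sup_{x\in X^{\mathrm{in}}}\left(x^\intercal (A^k)^\intercal QA^kx+q^\intercal A^kx\right)$. For a Hermitian matrix $B$, $\mu(B)=\sup_{x\in X^{\mathrm{in}}}x^\intercal Bx$ (a real number). $V_{\rm diag}=\dfrac{\|U^*q\|_2}{2\sqrt{|\lambda_{\max}(U^*QU)|}}$, where $\lambda_{\max}(U^*QU)\neq0$ because $\lambda_{\max}(Q)\ne 0$. In the degenerate case $\rho(A)=0$ the convention is $\ln 0=-\infty$ and $c/(-\infty)=0$ for real $c$, so that $\mathbf K^{\rm diag}_\nu(j)=1$. *)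

theory Defs
  imports "HOL-Analysis.Analysis"
begin

definition cmat :: "real^'n^'m \<Rightarrow> complex^'n^'m" where
  "cmat = map_matrix complex_of_real"

definition cvec :: "real^'n \<Rightarrow> complex^'n" where
  "cvec x = (\<chi> i. complex_of_real (x $ i))"

definition ctranspose :: "complex^'n^'m \<Rightarrow> complex^'m^'n" where
  "ctranspose U = (\<chi> i j. cnj (U $ j $ i))"

definition diagonal_matrix :: "'a::zero^'n^'n \<Rightarrow> bool" where
  "diagonal_matrix D \<longleftrightarrow> (\<forall>i j. i \<noteq> j \<longrightarrow> D $ i $ j = 0)"

text \<open>Powers with respect to the matrix product; the multiplication of the type class instance
  for vectors is componentwise.\<close>

primrec matrix_power :: "'a::semiring_1^'n^'n \<Rightarrow> nat \<Rightarrow> 'a^'n^'n" where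
  "matrix_power A 0 = mat 1"
| "matrix_power A (Suc k) = A ** matrix_power A k"

definition matrix_spectrum :: "complex^'n^'n \<Rightarrow> complex set" where
  "matrix_spectrum B = {c. \<exists>v. v \<noteq> 0 \<and> B *v v = c *s v}"

definition spectral_radius :: "complex^'n^'n \<Rightarrow> real" where
  "spectral_radius B = Max (cmod ` matrix_spectrum B)"

text \<open>Only meant for Hermitian matrices, all of whose eigenvalues are real.\<close>

definition lambda_max :: "complex^'n^'n \<Rightarrow> real" where
  "lambda_max B = Max {r. complex_of_real r \<in> matrix_spectrum B}"

definition nu :: "(real^'n) set \<Rightarrow> real^'n^'n \<Rightarrow> real^'n^'n \<Rightarrow> real^'n \<Rightarrow> nat \<Rightarrow> real" where
  "nu X A Q q k =
    (SUP x\<in>X. x \<bullet> ((transpose (matrix_power A k) ** Q ** matrix_power A k) *v x)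
              + q \<bullet> (matrix_power A k *v x))"

text \<open>For Hermitian \<open>B\<close> and real \<open>x\<close> the double sum is real, so \<open>Re\<close> only adjusts the type.\<close>

definition mu :: "(real^'n) set \<Rightarrow> complex^'n^'n \<Rightarrow> real" where
  "mu X B =
    (SUP x\<in>X. Re (\<Sum>i\<in>UNIV. \<Sum>j\<in>UNIV. complex_of_real (x $ i) * B $ i $ j * complex_of_real (x $ j)))"

definition lambda_diag :: "real^'n^'n \<Rightarrow> complex^'n^'n \<Rightarrow> real" where
  "lambda_diag Q U = lambda_max (ctranspose U ** cmat Q ** U)"

definition mu_diag :: "(real^'n) set \<Rightarrow> complex^'n^'n \<Rightarrow> real" where
  "mu_diag X U = mu X (matrix_inv (U ** ctranspose U))"

definition V_diag :: "real^'n^'n \<Rightarrow> real^'n \<Rightarrow> complex^'n^'n \<Rightarrow> real" where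
  "V_diag Q q U = norm (ctranspose U *v cvec q) / (2 * sqrt \<bar>lambda_diag Q U\<bar>)"

text \<open>The argument of the logarithm in the numerator of \<open>K_diag\<close>.\<close>

definition log_arg_diag ::
    "(real^'n) set \<Rightarrow> real^'n^'n \<Rightarrow> real^'n^'n \<Rightarrow> real^'n \<Rightarrow> complex^'n^'n \<Rightarrow> nat \<Rightarrow> real" where
  "log_arg_diag X A Q q U j =
    (sqrt (nu X A Q q j + (V_diag Q q U)\<^sup>2) - V_diag Q q U)
      * inverse (sqrt (\<bar>lambda_diag Q U\<bar> * mu_diag X U))"

text \<open>The case distinction implements the convention that \<open>ln 0\<close> is minus infinity and
  \<open>c / ln 0\<close> is \<open>0\<close>; it does not rely on the library's value of \<open>ln 0\<close>.\<close>

definition K_diag ::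
    "(real^'n) set \<Rightarrow> real^'n^'n \<Rightarrow> real^'n^'n \<Rightarrow> real^'n \<Rightarrow> complex^'n^'n \<Rightarrow> nat \<Rightarrow> int" where
  "K_diag X A Q q U j =
    \<lfloor>if spectral_radius (cmat A) = 0 then 0
     else ln (log_arg_diag X A Q q U j) / ln (spectral_radius (cmat A))\<rfloor> + 1"

end

theory Submission
  imports Defs
begin

text \<open>
  Let \<open>\<lambda>\<close> be the largest eigenvalue of \<open>U\<^sup>* Q U\<close>, \<open>\<mu>\<close> the value \<^term>\<open>mu_diag X U\<close>,
  \<open>\<rho>\<close> the spectral radius of \<open>A\<close>, and \<open>V\<close> the value \<^term>\<open>V_diag Q q U\<close>.
  In the coordinates \<open>y = U\<^sup>-\<^sup>1 x\<close> the matrix \<open>A\<^sup>k\<close> becomes \<open>D\<^sup>k\<close>, which shrinks norms by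
  the factor \<open>\<rho>\<^sup>k\<close>, the quadratic part of the objective becomes the form of \<open>U\<^sup>* Q U\<close>, which is
  at most \<open>\<bar>\<lambda>\<bar>\<close> times the squared norm, and the linear part becomes the inner product with
  \<open>U\<^sup>* q\<close>. On the initial set \<open>\<parallel>y\<parallel>\<^sup>2 = x\<^sup>T (U U\<^sup>*)\<^sup>-\<^sup>1 x\<close> is at most \<open>\<mu>\<close>. With
  \<open>t\<^sub>k = \<rho>\<^sup>k \<surd>(\<bar>\<lambda>\<bar> \<mu>)\<close>, completing the square gives
  \<open>\<nu>\<^sub>k \<le> t\<^sub>k\<^sup>2 + 2 V t\<^sub>k = (t\<^sub>k + V)\<^sup>2 - V\<^sup>2\<close> (lemma \<open>nu_le\<close>).

  For nonnegative \<open>t\<close>, the right-hand side is at most \<open>\<nu>\<^sub>j\<close> iff \<open>t \<le> s\<close>, where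
  \<open>s = \<surd>(\<nu>\<^sub>j + V\<^sup>2) - V > 0\<close>; and \<open>t\<^sub>k \<le> s\<close> says that \<open>\<rho>\<^sup>k\<close> is at most the argument
  \<open>L = s / \<surd>(\<bar>\<lambda>\<bar> \<mu>)\<close> of the logarithm. So every \<open>k > ln L / ln \<rho>\<close> satisfies
  \<open>\<nu>\<^sub>k \<le> \<nu>\<^sub>j\<close>; if \<open>\<rho> = 0\<close>, then \<open>t\<^sub>k = 0\<close> for all \<open>k \<ge> 1\<close>, and the same
  comparison applies. The bound at \<open>k = j\<close> itself forces \<open>L \<le> \<rho>\<^sup>j \<le> 1\<close>, hence
  \<open>ln L / ln \<rho> \<ge> 0\<close> for \<open>\<rho> > 0\<close>, and the index is at least \<open>1\<close>.

  The spectral facts needed are that the largest real eigenvalue of a Hermitian matrix is a genuine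
  maximum which bounds its Rayleigh quotient (\<open>lambda_max_hermitian\<close>), and that passing from \<open>Q\<close>
  to \<open>U\<^sup>* Q U\<close> keeps it nonzero (\<open>lambda_max_congruence_nonzero\<close>). Both are obtained by viewing
  \<open>\<complex>\<^sup>n\<close> as a Euclidean space over the reals, with inner product
  \<open>Re (x\<^sup>* y)\<close>: a Hermitian matrix acts on it as a self-adjoint real-linear map, and its real
  eigenvalues are those of that map.
\<close>

section \<open>The largest eigenvalue of a self-adjoint map\<close>

text \<open>If \<open>g v\<close> were nonzero, moving from \<open>v\<close> a little in the direction \<open>- g v\<close> would make the
  form negative, since its first-order change there is \<open>- 2 \<parallel>g v\<parallel>\<^sup>2\<close>.\<close>

lemma psd_form_zero_imp_kernel:
  fixes g :: "'a::euclidean_space \<Rightarrow> 'a"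
  assumes lin: "linear g" and sym: "\<And>x y. x \<bullet> g y = g x \<bullet> y"
    and psd: "\<And>w. 0 \<le> w \<bullet> g w" and zero: "v \<bullet> g v = 0"
  shows "g v = 0"
proof (rule ccontr)
  assume nz: "g v \<noteq> 0"
  define a where "a = g v \<bullet> g v"
  define b where "b = g v \<bullet> g (g v)"
  have a: "a > 0" using nz by (simp add: a_def)
  have b: "b \<ge> 0" using psd by (simp add: b_def)
  \<comment> \<open>The form at \<open>v + t g v\<close> is \<open>2 t a + t\<^sup>2 b\<close>, with minimum at \<open>t = - a / b\<close>;
    adding \<open>1\<close> to \<open>b\<close> avoids division by zero and keeps the value negative.\<close>
  define t where "t = - a / (b + 1)"
  have "(v + t *\<^sub>R g v) \<bullet> g (v + t *\<^sub>R g v) = 2 * t * a + t\<^sup>2 * b"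
    using zero sym[of v "g v"]
    by (simp add: linear_add[OF lin] linear_scale[OF lin] inner_add_left inner_add_right
        a_def b_def power2_eq_square algebra_simps)
  also have "\<dots> = - (t\<^sup>2 * (b + 2))"
  proof -
    have eq: "a = - (t * (b + 1))" using b by (simp add: t_def)
    show ?thesis by (subst eq) (simp add: power2_eq_square algebra_simps)
  qed
  also have "\<dots> < 0" using a b by (simp add: t_def)
  finally show False using psd[of "v + t *\<^sub>R g v"] by linarith
qed

text \<open>By compactness the form \<open>w \<bullet> f w\<close> attains a maximum \<open>c\<close> on the unit sphere. Then
  \<open>c w - f w\<close> is a positive semidefinite map whose form vanishes at the maximizer, so the maximizer
  lies in its kernel, that is, it is an eigenvector for \<open>c\<close>.\<close>

lemma self_adjoint_rayleigh_maximizer: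
  fixes f :: "'a::euclidean_space \<Rightarrow> 'a"
  assumes lin: "linear f" and sym: "\<And>x y. x \<bullet> f y = f x \<bullet> y"
  obtains v c where "v \<noteq> 0" "f v = c *\<^sub>R v" "\<And>w. w \<bullet> f w \<le> c * (norm w)\<^sup>2"
proof -
  have "continuous_on (sphere 0 1) (\<lambda>w. w \<bullet> f w)"
    by (intro continuous_intros linear_continuous_on linear_linear[THEN iffD2] lin)
  moreover have "(sphere 0 1 :: 'a set) \<noteq> {}" by simp
  ultimately obtain v where v: "v \<in> sphere 0 1"
    and vmax: "\<And>w. w \<in> sphere 0 1 \<Longrightarrow> w \<bullet> f w \<le> v \<bullet> f v"
    using continuous_attains_sup[of "sphere 0 1 :: 'a set" "\<lambda>w. w \<bullet> f w"] by auto
  define c where "c = v \<bullet> f v"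
  have nv: "norm v = 1" using v by simp
  have bound: "w \<bullet> f w \<le> c * (norm w)\<^sup>2" for w
  proof (cases "w = 0")
    case True
    then show ?thesis by (simp add: linear_0[OF lin])
  next
    case False
    have "(w /\<^sub>R norm w) \<bullet> f (w /\<^sub>R norm w) \<le> c"
      unfolding c_def using False by (intro vmax) simp
    then have "(w \<bullet> f w) / (norm w)\<^sup>2 \<le> c"
      by (simp add: linear_scale[OF lin] power2_eq_square divide_simps)
    then show ?thesis using False by (simp add: divide_simps)
  qed
  define g where "g w = c *\<^sub>R w - f w" for w
  have "linear g"
    unfolding g_def by (intro linear_compose_sub linear_compose_scale_right linear_ident lin)
  then have "g v = 0"
  proof (rule psd_form_zero_imp_kernel)
    show "x \<bullet> g y = g x \<bullet> y" for x y by (simp add: g_def inner_diff sym)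
    show "0 \<le> w \<bullet> g w" for w
      using bound[of w] by (simp add: g_def inner_diff power2_norm_eq_inner)
    show "v \<bullet> g v = 0"
      using nv by (simp add: g_def inner_diff c_def flip: power2_norm_eq_inner)
  qed
  then have "f v = c *\<^sub>R v" by (simp add: g_def)
  moreover have "v \<noteq> 0" using nv by auto
  ultimately show thesis using that bound by blast
qed

text \<open>Eigenvectors for distinct eigenvalues are orthogonal, hence linearly independent, so there are
  at most as many eigenvalues as dimensions.\<close>

lemma self_adjoint_finite_eigenvalues:
  fixes f :: "'a::euclidean_space \<Rightarrow> 'a"
  assumes sym: "\<And>x y. x \<bullet> f y = f x \<bullet> y"
  shows "finite {r. \<exists>v. v \<noteq> 0 \<and> f v = r *\<^sub>R v}" (is "finite ?R")
proof -
  have "\<forall>r\<in>?R. \<exists>v. v \<noteq> 0 \<and> f v = r *\<^sub>R v" by simp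
  from bchoice[OF this] obtain e
    where e: "\<And>r. r \<in> ?R \<Longrightarrow> e r \<noteq> 0 \<and> f (e r) = r *\<^sub>R e r" by blast
  have orth: "e r \<bullet> e s = 0" if "r \<in> ?R" "s \<in> ?R" "r \<noteq> s" for r s
  proof -
    have "s * (e r \<bullet> e s) = r * (e r \<bullet> e s)"
      using sym[of "e r" "e s"] e[OF that(1)] e[OF that(2)] by simp
    then show ?thesis using \<open>r \<noteq> s\<close> by simp
  qed
  have "inj_on e ?R"
  proof (rule inj_onI, rule ccontr)
    fix r s assume rs: "r \<in> ?R" "s \<in> ?R" "e r = e s" "r \<noteq> s"
    then have "e r \<bullet> e r = 0" using orth[OF rs(1,2,4)] by simp
    then show False using e[OF rs(1)] by simp
  qed
  moreover have "independent (e ` ?R)"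
  proof (rule pairwise_orthogonal_independent)
    show "pairwise orthogonal (e ` ?R)"
      unfolding pairwise_def orthogonal_def using orth by blast
    show "0 \<notin> e ` ?R" using e by force
  qed
  then have "finite (e ` ?R)" by (rule independent_imp_finite)
  ultimately show ?thesis using finite_imageD by blast
qed

section \<open>Complex matrices and the real inner product\<close>

text \<open>The inner product on complex vectors is the real part of the Hermitian one; passing to real
  parts does not affect the adjoint.\<close>

lemma inner_ctranspose:
  "(ctranspose U *v x) \<bullet> y = x \<bullet> (U *v y)"
proof -
  have "(ctranspose U *v x) \<bullet> y = (\<Sum>j\<in>UNIV. \<Sum>i\<in>UNIV. (cnj (U$i$j) * x$i) \<bullet> y$j)"
    by (simp add: inner_vec_def matrix_vector_mult_def ctranspose_def inner_sum_left)
  also have "\<dots> = (\<Sum>j\<in>UNIV. \<Sum>i\<in>UNIV. x$i \<bullet> (U$i$j * y$j))"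
    by (intro sum.cong refl) (simp add: inner_complex_def algebra_simps)
  also have "\<dots> = x \<bullet> (U *v y)"
    by (subst sum.swap) (simp add: inner_vec_def matrix_vector_mult_def inner_sum_right)
  finally show ?thesis .
qed

lemma ctranspose_mult: "ctranspose (A ** B) = ctranspose B ** ctranspose A"
  by (simp add: ctranspose_def matrix_matrix_mult_def vec_eq_iff mult.commute)

lemma ctranspose_ctranspose: "ctranspose (ctranspose A) = A"
  by (simp add: ctranspose_def vec_eq_iff)

lemma ctranspose_mat_1: "ctranspose (mat 1) = mat 1"
  by (simp add: ctranspose_def mat_def vec_eq_iff)

lemma invertible_ctranspose:
  assumes "invertible U"
  shows "invertible (ctranspose U)"
  using assms unfolding invertible_def by (metis ctranspose_mult ctranspose_mat_1)

lemma ctranspose_cmat: "ctranspose (cmat Q) = cmat (transpose Q)"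
  by (simp add: ctranspose_def cmat_def map_matrix_def transpose_def vec_eq_iff)

lemma inner_cvec: "cvec x \<bullet> cvec y = x \<bullet> y"
  by (simp add: inner_vec_def cvec_def inner_complex_def)

lemma cmat_mult_cvec: "cmat A *v cvec x = cvec (A *v x)"
  by (simp add: cmat_def map_matrix_def cvec_def matrix_vector_mult_def vec_eq_iff)

lemma cvec_eq_0_iff: "cvec x = 0 \<longleftrightarrow> x = 0"
  by (simp add: cvec_def vec_eq_iff)

lemma complex_scale_of_real: "complex_of_real r *s (v :: complex^'n) = r *\<^sub>R v"
  by (simp add: vec_eq_iff) (simp add: scaleR_conv_of_real)

lemma linear_complex_matrix: "linear (\<lambda>v. (M :: complex^'n^'n) *v v)"
proof (rule linearI)
  show "M *v (x + y) = M *v x + M *v y" for x y by (rule matrix_vector_right_distrib)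
  show "M *v (r *\<^sub>R x) = r *\<^sub>R (M *v x)" for r x
    by (simp add: matrix_vector_mult_def vec_eq_iff scaleR_sum_right)
qed

text \<open>\<^const>\<open>lambda_max\<close> is defined by a \<^const>\<open>Max\<close>, which is meaningful only for a finite
  nonempty set; the two preceding facts on self-adjoint maps supply finiteness and nonemptiness. The
  Rayleigh maximizer is one of the eigenvalues compared, whence the bound.\<close>

lemma lambda_max_hermitian:
  fixes M :: "complex^'n^'n"
  assumes "ctranspose M = M"
  shows lambda_max_eigenvector: "\<exists>v. v \<noteq> 0 \<and> M *v v = lambda_max M *\<^sub>R v"
    and rayleigh_le_lambda_max: "w \<bullet> (M *v w) \<le> lambda_max M * (norm w)\<^sup>2"
proof -
  let ?R = "{r. \<exists>v. v \<noteq> 0 \<and> M *v v = r *\<^sub>R v}"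
  have sym: "x \<bullet> (M *v y) = (M *v x) \<bullet> y" for x y
    using inner_ctranspose[of M x y] assms by simp
  have eq: "lambda_max M = Max ?R"
    by (simp add: lambda_max_def matrix_spectrum_def complex_scale_of_real)
  have fin: "finite ?R" by (rule self_adjoint_finite_eigenvalues[OF sym])
  obtain v c where vc: "v \<noteq> 0" "M *v v = c *\<^sub>R v" "\<And>w. w \<bullet> (M *v w) \<le> c * (norm w)\<^sup>2"
    using self_adjoint_rayleigh_maximizer[OF linear_complex_matrix sym] by blast
  then have c: "c \<in> ?R" by blast
  then have "Max ?R \<in> ?R" using fin Max_in by blast
  then show "\<exists>v. v \<noteq> 0 \<and> M *v v = lambda_max M *\<^sub>R v" by (simp add: eq)
  have "c \<le> lambda_max M" using fin c by (simp add: eq)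
  then have "c * (norm w)\<^sup>2 \<le> lambda_max M * (norm w)\<^sup>2" by (rule mult_right_mono) simp
  then show "w \<bullet> (M *v w) \<le> lambda_max M * (norm w)\<^sup>2" using vc(3)[of w] by linarith
qed

lemma matrix_inv_mult_vec:
  fixes U :: "complex^'n^'n"
  assumes "invertible U"
  shows "matrix_inv U *v (U *v x) = x" and "U *v (matrix_inv U *v x) = x"
proof -
  have "U ** matrix_inv U = mat 1 \<and> matrix_inv U ** U = mat 1"
    unfolding matrix_inv_def by (rule someI_ex) (use assms in \<open>simp add: invertible_def\<close>)
  then show "matrix_inv U *v (U *v x) = x" and "U *v (matrix_inv U *v x) = x"
    by (simp_all add: matrix_vector_mul_assoc)
qed

lemma congruence_form:
  "w \<bullet> ((ctranspose U ** M ** U) *v w) = (U *v w) \<bullet> (M *v (U *v w))"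
  using inner_ctranspose[of U "M *v (U *v w)" w]
  by (simp add: inner_commute flip: matrix_vector_mul_assoc)

text \<open>A weak form of Sylvester's law of inertia: the substitution \<open>v = U w\<close> carries a direction of
  positivity of \<open>M\<close> to one of the congruent matrix, and negative definiteness is also inherited, so
  the largest eigenvalue keeps its strict sign.\<close>

lemma lambda_max_congruence_nonzero:
  fixes M U :: "complex^'n^'n"
  assumes herm: "ctranspose M = M" and inv: "invertible U" and nz: "lambda_max M \<noteq> 0"
  shows "lambda_max (ctranspose U ** M ** U) \<noteq> 0"
proof -
  let ?N = "ctranspose U ** M ** U"
  have hermN: "ctranspose ?N = ?N"
    by (simp add: ctranspose_mult ctranspose_ctranspose herm matrix_mul_assoc)
  show ?thesis
  proof (cases "lambda_max M > 0")
    case True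
    obtain v where v: "v \<noteq> 0" "M *v v = lambda_max M *\<^sub>R v"
      using lambda_max_eigenvector[OF herm] by blast
    let ?w = "matrix_inv U *v v"
    have "?w \<bullet> (?N *v ?w) = lambda_max M * (v \<bullet> v)"
      by (simp add: congruence_form matrix_inv_mult_vec[OF inv] v(2))
    then have "0 < lambda_max ?N * (norm ?w)\<^sup>2"
      using rayleigh_le_lambda_max[OF hermN, of ?w] True v(1)
      by (metis inner_gt_zero_iff less_le_trans mult_pos_pos)
    then show ?thesis by auto
  next
    case False
    obtain w where w: "w \<noteq> 0" "?N *v w = lambda_max ?N *\<^sub>R w"
      using lambda_max_eigenvector[OF hermN] by blast
    have "U *v w \<noteq> 0"
      using w(1) matrix_inv_mult_vec(1)[OF inv, of w] by auto
    then have "lambda_max M * (norm (U *v w))\<^sup>2 < 0"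
      using False nz by (simp add: mult_less_0_iff)
    then have "w \<bullet> (?N *v w) < 0"
      using rayleigh_le_lambda_max[OF herm, of "U *v w"] by (simp add: congruence_form)
    then show ?thesis using w by auto
  qed
qed

section \<open>Diagonalizable matrices\<close>

lemma diagonal_matrix_vec:
  fixes D :: "'a::semiring_1^'n^'n"
  assumes "diagonal_matrix D"
  shows "(D *v y) $ i = D $ i $ i * y $ i"
proof -
  have "(D *v y) $ i = (\<Sum>j\<in>UNIV. if j = i then D $ i $ i * y $ i else 0)"
    unfolding matrix_vector_mult_def vec_lambda_beta
    using assms by (intro sum.cong refl) (auto simp: diagonal_matrix_def)
  then show ?thesis by simp
qed

lemma matrix_spectrum_diagonalizable:
  fixes B U D :: "complex^'n^'n"
  assumes inv: "invertible U" and diag: "diagonal_matrix D" and B: "B = U ** D ** matrix_inv U"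
  shows "matrix_spectrum B = range (\<lambda>i. D $ i $ i)"
proof (intro equalityI subsetI)
  fix c assume "c \<in> matrix_spectrum B"
  then obtain v where v: "v \<noteq> 0" "B *v v = c *s v" by (auto simp: matrix_spectrum_def)
  define y where "y = matrix_inv U *v v"
  have "U *v (D *v y) = c *s v"
    using v(2) by (simp add: B y_def flip: matrix_vector_mul_assoc)
  then have "D *v y = matrix_inv U *v (c *s v)"
    using matrix_inv_mult_vec(1)[OF inv, of "D *v y"] by simp
  then have Dy: "D *v y = c *s y"
    by (simp add: y_def vector_scalar_commute)
  have "y \<noteq> 0" using v(1) matrix_inv_mult_vec(2)[OF inv, of v] by (auto simp: y_def)
  then obtain i where "y $ i \<noteq> 0" by (auto simp: vec_eq_iff)
  then have "c = D $ i $ i"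
    using diagonal_matrix_vec[OF diag, of y i] by (simp add: Dy)
  then show "c \<in> range (\<lambda>i. D $ i $ i)" by blast
next
  fix c assume "c \<in> range (\<lambda>i. D $ i $ i)"
  then obtain i where c: "c = D $ i $ i" by blast
  define e :: "complex^'n" where "e = axis i 1"
  have De: "D *v e = c *s e"
    by (simp add: vec_eq_iff diagonal_matrix_vec[OF diag] e_def axis_def c)
  have "e \<noteq> 0" by (simp add: e_def axis_eq_0_iff)
  then have "U *v e \<noteq> 0" using matrix_inv_mult_vec(1)[OF inv, of e] by auto
  moreover have "B *v (U *v e) = c *s (U *v e)"
    using De by (simp add: B matrix_inv_mult_vec[OF inv] vector_scalar_commute
        flip: matrix_vector_mul_assoc)
  ultimately show "c \<in> matrix_spectrum B" by (auto simp: matrix_spectrum_def)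
qed

text \<open>The spectrum is the set of diagonal entries, so the \<^const>\<open>Max\<close> in the definition of
  \<^const>\<open>spectral_radius\<close> ranges over a finite nonempty set.\<close>

lemma spectral_radius_diagonalizable:
  fixes B U D :: "complex^'n^'n"
  assumes "invertible U" "diagonal_matrix D" "B = U ** D ** matrix_inv U"
  shows cmod_diagonal_le_spectral_radius: "cmod (D $ i $ i) \<le> spectral_radius B"
    and spectral_radius_nonneg: "0 \<le> spectral_radius B"
proof -
  show "cmod (D $ i $ i) \<le> spectral_radius B" for i
    unfolding spectral_radius_def matrix_spectrum_diagonalizable[OF assms] by (rule Max_ge) auto
  from order_trans[OF norm_ge_zero this] show "0 \<le> spectral_radius B" .
qed

lemma cvec_matrix_power_diagonalizable:
  fixes U D :: "complex^'n^'n"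
  assumes inv: "invertible U" and diag: "diagonal_matrix D"
    and A: "cmat A = U ** D ** matrix_inv U"
  shows "cvec (matrix_power A k *v x) =
    U *v (\<chi> i. (D $ i $ i) ^ k * (matrix_inv U *v cvec x) $ i)"
proof (induction k)
  case 0
  then show ?case by (simp add: matrix_inv_mult_vec[OF inv])
next
  case (Suc k)
  let ?y = "\<lambda>k. \<chi> i. (D $ i $ i) ^ k * (matrix_inv U *v cvec x) $ i"
  have "cvec (matrix_power A (Suc k) *v x) = cmat A *v cvec (matrix_power A k *v x)"
    by (simp add: cmat_mult_cvec flip: matrix_vector_mul_assoc)
  also have "\<dots> = U *v (D *v ?y k)"
    unfolding Suc A by (simp add: matrix_inv_mult_vec[OF inv] flip: matrix_vector_mul_assoc)
  also have "D *v ?y k = ?y (Suc k)"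
    by (simp add: vec_eq_iff diagonal_matrix_vec[OF diag])
  finally show ?case .
qed

lemma norm_diagonal_scaling_le:
  fixes y :: "complex^'n"
  assumes "\<And>i. cmod (a i) \<le> r" and "0 \<le> r"
  shows "norm (\<chi> i. (a i) ^ k * y $ i) \<le> r ^ k * norm y"
proof -
  have "norm (\<chi> i. (a i) ^ k * y $ i) \<le> norm (r ^ k *\<^sub>R y)"
    using assms by (intro norm_le_componentwise_cart)
      (simp add: norm_mult norm_power mult_right_mono power_mono)
  then show ?thesis using assms(2) by simp
qed

section \<open>The ellipsoidal bound on the initial set\<close>

text \<open>Because \<open>(U U\<^sup>*)\<^sup>-\<^sup>1 = (U\<^sup>-\<^sup>1)\<^sup>* U\<^sup>-\<^sup>1\<close>, the form whose supremum defines
  \<^const>\<open>mu_diag\<close> is the squared norm of the initial state in the eigenvector coordinates.\<close>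

lemma mu_form_eq:
  fixes U :: "complex^'n^'n"
  assumes inv: "invertible U"
  shows "Re (\<Sum>i\<in>UNIV. \<Sum>j\<in>UNIV. complex_of_real (x $ i) * matrix_inv (U ** ctranspose U) $ i $ j
      * complex_of_real (x $ j)) = (norm (matrix_inv U *v cvec x))\<^sup>2"
proof -
  let ?B = "matrix_inv (U ** ctranspose U)"
  let ?y = "matrix_inv U *v cvec x"
  have "invertible (U ** ctranspose U)"
    using inv invertible_ctranspose invertible_mult by blast
  then have "U *v (ctranspose U *v (?B *v cvec x)) = cvec x"
    using matrix_inv_mult_vec(2)[of "U ** ctranspose U"] by (simp add: matrix_vector_mul_assoc matrix_mul_assoc)
  then have y: "ctranspose U *v (?B *v cvec x) = ?y"
    using matrix_inv_mult_vec(1)[OF inv] by metis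
  have "Re (\<Sum>i\<in>UNIV. \<Sum>j\<in>UNIV. complex_of_real (x $ i) * ?B $ i $ j * complex_of_real (x $ j))
      = cvec x \<bullet> (?B *v cvec x)"
    by (simp add: inner_vec_def matrix_vector_mult_def cvec_def inner_complex_def
        sum_distrib_left algebra_simps)
  also have "\<dots> = (ctranspose U *v (?B *v cvec x)) \<bullet> ?y"
    using inner_ctranspose[of U "?B *v cvec x" ?y]
    by (simp add: matrix_inv_mult_vec[OF inv] inner_commute)
  also have "\<dots> = (norm ?y)\<^sup>2" by (simp add: y power2_norm_eq_inner)
  finally show ?thesis .
qed

text \<open>Compactness of \<open>X\<close> makes the supremum in \<^const>\<open>mu_diag\<close> an upper bound.\<close>

lemma norm_le_mu_diag:
  fixes U :: "complex^'n^'n"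
  assumes inv: "invertible U" and X: "compact X" and x: "x \<in> X"
  shows "(norm (matrix_inv U *v cvec x))\<^sup>2 \<le> mu_diag X U"
proof -
  have "linear (\<lambda>x. matrix_inv U *v cvec x)"
    using linear_compose[OF _ linear_complex_matrix[of "matrix_inv U"], of cvec]
    by (simp add: o_def linear_iff cvec_def vec_eq_iff) (simp add: scaleR_conv_of_real)
  then have "continuous_on X (\<lambda>x. (norm (matrix_inv U *v cvec x))\<^sup>2)"
    by (intro continuous_intros linear_continuous_on) (simp add: linear_linear)
  then have "bdd_above ((\<lambda>x. (norm (matrix_inv U *v cvec x))\<^sup>2) ` X)"
    using X by (intro bounded_imp_bdd_above compact_imp_bounded compact_continuous_image)
  then show ?thesis
    unfolding mu_diag_def mu_def mu_form_eq[OF inv] by (rule cSUP_upper[OF x])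
qed

lemma mu_diag_pos:
  fixes U :: "complex^'n^'n"
  assumes inv: "invertible U" and X: "compact X" and x: "x \<in> X" "x \<noteq> 0"
  shows "0 < mu_diag X U"
proof -
  have "matrix_inv U *v cvec x \<noteq> 0"
    using matrix_inv_mult_vec(2)[OF inv, of "cvec x"] x(2) by (auto simp: cvec_eq_0_iff)
  then have "0 < (norm (matrix_inv U *v cvec x))\<^sup>2" by simp
  also have "\<dots> \<le> mu_diag X U" by (rule norm_le_mu_diag[OF inv X x(1)])
  finally show ?thesis .
qed

section \<open>The bound on the values and the stopping index\<close>

text \<open>With \<open>z = D\<^sup>k U\<^sup>-\<^sup>1 x\<close>, the quadratic part is at most \<open>\<bar>\<lambda>\<bar> \<parallel>z\<parallel>\<^sup>2\<close> and the
  linear part at most \<open>\<parallel>U\<^sup>* q\<parallel> \<parallel>z\<parallel>\<close>, while \<open>\<parallel>z\<parallel> \<le> \<rho>\<^sup>k \<surd>\<mu>\<close>. The normalization in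
  \<^const>\<open>V_diag\<close> is the one that makes the sum of both bounds complete to a square in \<open>t k\<close>.\<close>

lemma nu_le:
  fixes U D :: "complex^'n^'n"
  assumes X: "compact X" "X \<noteq> {}"
    and inv: "invertible U" and diag: "diagonal_matrix D"
    and A: "cmat A = U ** D ** matrix_inv U"
    and Q: "transpose Q = Q"
    and nz: "lambda_diag Q U \<noteq> 0"
  defines "t k \<equiv> spectral_radius (cmat A) ^ k * sqrt (\<bar>lambda_diag Q U\<bar> * mu_diag X U)"
  shows "nu X A Q q k \<le> (t k + V_diag Q q U)\<^sup>2 - (V_diag Q q U)\<^sup>2"
  unfolding nu_def
proof (rule cSUP_least[OF X(2)])
  fix x assume x: "x \<in> X"
  let ?P = "matrix_power A k" and ?r = "spectral_radius (cmat A)"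
  let ?N = "ctranspose U ** cmat Q ** U" and ?l = "\<bar>lambda_diag Q U\<bar>"
  let ?m = "sqrt (mu_diag X U)"
  define y where "y = matrix_inv U *v cvec x"
  define z where "z = (\<chi> i. (D $ i $ i) ^ k * y $ i)"
  have Px: "cvec (?P *v x) = U *v z"
    unfolding z_def y_def by (rule cvec_matrix_power_diagonalizable[OF inv diag A])
  have r: "0 \<le> ?r" using spectral_radius_nonneg[OF inv diag A] .
  have "norm y \<le> ?m"
    using norm_le_mu_diag[OF inv X(1) x] by (simp add: y_def real_le_rsqrt)
  moreover have "norm z \<le> ?r ^ k * norm y"
    unfolding z_def using cmod_diagonal_le_spectral_radius[OF inv diag A] r
    by (rule norm_diagonal_scaling_le)
  ultimately have z: "norm z \<le> ?r ^ k * ?m"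
    by (meson mult_left_mono order_trans r zero_le_power)
  have herm: "ctranspose ?N = ?N"
    by (simp add: ctranspose_mult ctranspose_ctranspose ctranspose_cmat Q matrix_mul_assoc)
  have "(transpose ?P ** Q ** ?P) *v x = (Q *v (?P *v x)) v* ?P"
    by (simp add: transpose_matrix_vector flip: matrix_vector_mul_assoc)
  then have "x \<bullet> ((transpose ?P ** Q ** ?P) *v x) = (?P *v x) \<bullet> (Q *v (?P *v x))"
    using dot_lmul_matrix[of "Q *v (?P *v x)" ?P x] by (simp add: inner_commute)
  also have "\<dots> = z \<bullet> (?N *v z)"
    by (simp add: congruence_form Px[symmetric] cmat_mult_cvec inner_cvec)
  also have "\<dots> \<le> lambda_diag Q U * (norm z)\<^sup>2"
    unfolding lambda_diag_def by (rule rayleigh_le_lambda_max[OF herm])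
  \<comment> \<open>The eigenvalue may be negative, and then the upper bound on \<open>norm z\<close> is of use only
    after passing to the absolute value.\<close>
  also have "\<dots> \<le> ?l * (?r ^ k * ?m)\<^sup>2"
    by (intro mult_mono power_mono z) auto
  also have "\<dots> = (t k)\<^sup>2"
    by (simp add: t_def real_sqrt_mult power_mult_distrib)
  finally have quad: "x \<bullet> ((transpose ?P ** Q ** ?P) *v x) \<le> (t k)\<^sup>2" .
  have "q \<bullet> (?P *v x) = (ctranspose U *v cvec q) \<bullet> z"
    by (simp add: inner_ctranspose Px[symmetric] inner_cvec)
  also have "\<dots> \<le> norm (ctranspose U *v cvec q) * norm z"
    by (rule norm_cauchy_schwarz)
  also have "\<dots> \<le> norm (ctranspose U *v cvec q) * (?r ^ k * ?m)"
    by (intro mult_left_mono z) auto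
  also have "\<dots> = 2 * t k * V_diag Q q U"
    using nz by (simp add: V_diag_def t_def real_sqrt_mult)
  finally have lin: "q \<bullet> (?P *v x) \<le> 2 * t k * V_diag Q q U" .
  show "x \<bullet> ((transpose ?P ** Q ** ?P) *v x) + q \<bullet> (?P *v x)
      \<le> (t k + V_diag Q q U)\<^sup>2 - (V_diag Q q U)\<^sup>2"
    using quad lin by (simp add: power2_sum)
qed

theorem theorem1:
  fixes X :: "(real^'d) set"
    and A Q :: "real^'d^'d"
    and q :: "real^'d"
    and U D :: "complex^'d^'d"
    and j :: nat
  assumes "polytope X" and "X \<noteq> {}" and "X \<noteq> {0}"
    and "spectral_radius (cmat A) < 1"
    and "invertible U" and "diagonal_matrix D"
    and "cmat A = U ** D ** matrix_inv U"
    and "transpose Q = Q"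
    and "lambda_max (cmat Q) \<noteq> 0"
    and "nu X A Q q j > 0"
  shows "(lambda_diag Q U \<noteq> 0 \<and> \<bar>lambda_diag Q U\<bar> * mu_diag X U > 0 \<and>
          log_arg_diag X A Q q U j > 0 \<and> K_diag X A Q q U j \<ge> 1) \<and>
         (\<forall>k. int k \<ge> K_diag X A Q q U j \<longrightarrow> nu X A Q q k \<le> nu X A Q q j)"
proof -
  let ?\<nu> = "nu X A Q q" and ?V = "V_diag Q q U" and ?r = "spectral_radius (cmat A)"
  let ?L = "log_arg_diag X A Q q U j"
  have X: "compact X" using assms(1) by (rule polytope_imp_compact)
  obtain x where x: "x \<in> X" "x \<noteq> 0" using assms(2,3) by blast
  have nz: "lambda_diag Q U \<noteq> 0"
    unfolding lambda_diag_def using assms(8,9) \<open>invertible U\<close>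
    by (intro lambda_max_congruence_nonzero) (simp_all add: ctranspose_cmat)
  have pos: "\<bar>lambda_diag Q U\<bar> * mu_diag X U > 0"
    using nz mu_diag_pos[OF \<open>invertible U\<close> X x] by simp
  define c where "c = sqrt (\<bar>lambda_diag Q U\<bar> * mu_diag X U)"
  have c: "c > 0" using pos by (simp add: c_def)
  have r: "0 \<le> ?r" using spectral_radius_nonneg[OF assms(5-7)] .
  have V: "?V \<ge> 0" by (simp add: V_diag_def)
  define s where "s = sqrt (?\<nu> j + ?V\<^sup>2) - ?V"
  have s: "s > 0"
    using assms(10) V by (simp add: s_def real_less_rsqrt)
  have \<nu>j: "?\<nu> j = (s + ?V)\<^sup>2 - ?V\<^sup>2"
    using assms(10) by (simp add: s_def)
  have L: "?L = s / c" by (simp add: log_arg_diag_def s_def c_def divide_inverse)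
  have Lpos: "?L > 0" using s c by (simp add: L)
  have bound: "?\<nu> k \<le> (?r ^ k * c + ?V)\<^sup>2 - ?V\<^sup>2" for k
    unfolding c_def by (rule nu_le[OF X assms(2,5-8) nz])
  \<comment> \<open>Comparing the value at \<open>j\<close> with its own bound shows that the logarithm is not positive.\<close>
  have "(s + ?V)\<^sup>2 \<le> (?r ^ j * c + ?V)\<^sup>2" using bound[of j] \<nu>j by simp
  then have "s \<le> ?r ^ j * c" using V c r by (simp add: power2_le_iff_abs_le)
  also have "\<dots> \<le> c" using r assms(4) c by (simp add: power_le_one mult_left_le_one_le)
  finally have L1: "?L \<le> 1" using c by (simp add: L)
  have K1: "K_diag X A Q q U j \<ge> 1"
  proof (cases "?r = 0")
    case False
    have "0 \<le> ln ?L / ln ?r"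
      using False r assms(4) L1 Lpos by (intro divide_nonpos_neg) auto
    then show ?thesis using False by (simp add: K_diag_def)
  qed (simp add: K_diag_def)
  have "?\<nu> k \<le> ?\<nu> j" if k: "int k \<ge> K_diag X A Q q U j" for k
  proof -
    have "?r ^ k \<le> ?L"
    proof (cases "?r = 0")
      case True
      \<comment> \<open>The index is at least \<open>1\<close>, so the power vanishes here.\<close>
      then have "k > 0" using k K1 by simp
      then show ?thesis using True Lpos by (simp add: zero_power)
    next
      case False
      then have r0: "0 < ?r" using r by simp
      have "ln ?L / ln ?r < k" using k False by (simp add: K_diag_def) linarith
      \<comment> \<open>Multiplying by \<open>ln \<rho> < 0\<close> reverses the inequality.\<close>
      then have "k * ln ?r < ln ?L"
        using r0 assms(4) by (simp add: divide_less_eq)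
      then have "ln (?r ^ k) < ln ?L" using r0 by (simp add: ln_realpow)
      then show ?thesis using r0 Lpos by simp
    qed
    then have "?r ^ k * c \<le> s" using c by (simp add: L field_simps)
    then have "(?r ^ k * c + ?V)\<^sup>2 \<le> (s + ?V)\<^sup>2"
      using r c V by (intro power_mono) auto
    then show ?thesis using bound[of k] \<nu>j by simp
  qed
  then show ?thesis using nz pos Lpos K1 by blast
qed

end
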